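(* Let $\Gamma$ be a discrete subgroup of $\mathrm{PSL}(2,\mathbb{R})$ acting freely on $\mathbb{H}^2$ with $\Gamma\backslash\mathbb{H}^2$ compact. Then the geodesic flow $(\varphi^{\mathcal X}_t)_{t\in\mathbb{R}}$ on $\mathcal X=T^1(\Gamma\backslash\mathbb{H}^2)$ is neither positive separating nor negative separating.
   Context: Setting: $\mathbb{H}^2=\{z=x+iy\in\mathbb{C}: y>0\}$ is the hyperbolic plane with metric $ds^2=(dx^2+dy^2)/y^2$, on which $G=\mathrm{PSL}(2,\mathbb{R})=\mathrm{SL}(2,\mathbb{R})/\{\pm E_2\}$ acts by Möbius transformations. $X=\Gamma\backslash \mathrm{PSL}(2,\mathbb{R})=\{\Gamma g: g\in \mathrm{PSL}(2,\mathbb{R})\}$. $G$ carries a distance $d_G$ induced by a natural left-invariant Riemannian metric (normalized so that $d_G(a_t,e)=|t|/\sqrt2$, with $a_t$ as below), and $X$ carries the distance $d_X(\Gamma g_1,\Gamma g_2)=\inf_{\gamma\in\Gamma}d_G(g_1,\gamma g_2)$. The unit tangent bundle $\mathcal X=T^1(\Gamma\backslash\mathbb{H}^2)$ is identified with $X$ by the standard bijection $\Xi:\mathcal X\to X$, whose inverse sends $\Gamma g$ to the image in $\mathcal X$ of the vertical unit vector at $i\in\mathbb{H}^2$ moved by $g$; the distance on $\mathcal X$ is the one making $\Xi$ an isometry. Geodesic flow: let $a_t\in\mathrm{PSL}(2,\mathbb{R})$ be the class of $\begin{pmatrix} e^{t/2}&0\\0&e^{-t/2}\end{pmatrix}$.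 Put $\varphi_t(\Gamma g)=\Gamma g a_t$ on $X$; the geodesic flow on $\mathcal X$ is $\varphi^{\mathcal X}_t=\Xi^{-1}\circ\varphi_t\circ\Xi$. Positive (resp. negative) separating: a continuous flow $\phi:\mathbb{R}\times M\to M$ on a compact metric space $(M,d)$ is positive (resp. negative) separating if there exists $\delta>0$ such that, for all $x,y\in M$, if $d(\phi_t(x),\phi_t(y))<\delta$ for all $t\in[0,\infty)$ (resp. for all $t\in(-\infty,0]$), then $y=\phi_\tau(x)$ for some $\tau\in\mathbb{R}$. *)

theory Defs
  imports "HOL-Analysis.Analysis" "HOL-Algebra.Algebra"
begin

section \<open>The group \<open>PSL(2,\<real>)\<close>\<close>

definition SL2R :: "(real^2^2) monoid" where
  "SL2R = \<lparr>carrier = {A. det A = 1}, mult = (**), one = mat 1\<rparr>"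

definition SL2R_center :: "(real^2^2) set" where
  "SL2R_center = {mat 1, - mat 1}"

definition PSL2R :: "(real^2^2) set monoid" where
  "PSL2R = SL2R Mod SL2R_center"

definition PSL2R_class :: "real^2^2 \<Rightarrow> (real^2^2) set" where
  "PSL2R_class A = SL2R_center #>\<^bsub>SL2R\<^esub> A"

definition quotient_topology :: "'a topology \<Rightarrow> ('a \<Rightarrow> 'b) \<Rightarrow> 'b topology" where
  "quotient_topology T f =
     topology (\<lambda>U. U \<subseteq> f ` topspace T \<and> openin T {x \<in> topspace T. f x \<in> U})"

definition PSL2R_topology :: "(real^2^2) set topology" where
  "PSL2R_topology = quotient_topology (top_of_set (carrier SL2R)) PSL2R_class"

definition discrete_in_PSL2R :: "(real^2^2) set set \<Rightarrow> bool" where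
  "discrete_in_PSL2R \<Gamma> \<longleftrightarrow> subtopology PSL2R_topology \<Gamma> = discrete_topology \<Gamma>"

text \<open>
  The inner product \<open>tr (A\<^sup>T B)\<close> on the Lie algebra \<open>sl(2,\<real>)\<close> is extended to a left-invariant
  Riemannian metric, so a tangent vector \<open>V\<close> at \<open>A\<close> has length \<open>norm (A\<^sup>-\<^sup>1 V)\<close>; the norm of
  \<^typ>\<open>real^2^2\<close> is the Frobenius norm. Since \<open>SL(2,\<real>) \<rightarrow> PSL(2,\<real>)\<close> is a covering, curves in
  \<open>PSL(2,\<real>)\<close> are given by their lifts, which may begin and end at either representative.
  The lengths are collected by \<open>has_integral\<close>, not \<^const>\<open>integral\<close>: piecewise \<open>C\<^sup>1\<close> in the sense
  of the library permits an unbounded derivative near the exceptional points, and the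
  value \<open>0\<close> of \<^const>\<open>integral\<close> on non-integrable functions would make the infimum collapse.
  That this is the normalization \<open>d(a\<^sub>t, e) = \<bar>t\<bar> / sqrt 2\<close> is lemma \<open>PSL2R_dist_diag\<close>.
\<close>

definition PSL2R_lengths :: "(real^2^2) set \<Rightarrow> (real^2^2) set \<Rightarrow> real set" where
  "PSL2R_lengths g h = {L. \<exists>p :: real \<Rightarrow> real^2^2.
      p piecewise_C1_differentiable_on {0..1} \<and> p ` {0..1} \<subseteq> carrier SL2R \<and>
      p 0 \<in> g \<and> p 1 \<in> h \<and>
      ((\<lambda>t. norm (matrix_inv (p t) ** vector_derivative p (at t))) has_integral L) {0..1}}"

definition PSL2R_dist :: "(real^2^2) set \<Rightarrow> (real^2^2) set \<Rightarrow> real" where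
  "PSL2R_dist g h = Inf (PSL2R_lengths g h)"

definition PSL2R_diag :: "real \<Rightarrow> (real^2^2) set" where
  "PSL2R_diag t = PSL2R_class (vector [vector [exp (t / 2), 0], vector [0, exp (- t / 2)]])"


section \<open>Action on the hyperbolic plane and on its unit tangent bundle\<close>

definition upper_half_plane :: "complex set" where
  "upper_half_plane = {z. Im z > 0}"

definition SL2R_act :: "real^2^2 \<Rightarrow> complex \<Rightarrow> complex" where
  "SL2R_act A = moebius (of_real (A$1$1)) (of_real (A$1$2)) (of_real (A$2$1)) (of_real (A$2$2))"

text \<open>Both representatives of an element of \<open>PSL(2,\<real>)\<close> give the same transformation.\<close>

definition PSL2R_act :: "(real^2^2) set \<Rightarrow> complex \<Rightarrow> complex" where
  "PSL2R_act g = the_elem (SL2R_act ` g)"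

text \<open>Unit vectors are those with \<open>\<bar>v\<bar> / Im z = 1\<close>, as \<open>ds\<^sup>2 = (dx\<^sup>2 + dy\<^sup>2) / y\<^sup>2\<close>.\<close>

definition T1_upper_half_plane :: "(complex \<times> complex) set" where
  "T1_upper_half_plane = {(z, v). z \<in> upper_half_plane \<and> cmod v / Im z = 1}"

definition PSL2R_tangent_act :: "(real^2^2) set \<Rightarrow> complex \<times> complex \<Rightarrow> complex \<times> complex" where
  "PSL2R_tangent_act g = (\<lambda>(z, v). (PSL2R_act g z, deriv (PSL2R_act g) z * v))"

definition acts_freely :: "(real^2^2) set set \<Rightarrow> bool" where
  "acts_freely \<Gamma> \<longleftrightarrow>
     (\<forall>g\<in>\<Gamma>. \<forall>z\<in>upper_half_plane. PSL2R_act g z = z \<longrightarrow> g = \<one>\<^bsub>PSL2R\<^esub>)"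

text \<open>The surface \<open>\<Gamma>\H\<^sup>2\<close> as a topological space; its points are the \<open>\<Gamma>\<close>-orbits.\<close>

definition quotient_surface :: "(real^2^2) set set \<Rightarrow> complex set topology" where
  "quotient_surface \<Gamma> = quotient_topology (top_of_set upper_half_plane)
     (orbit (PSL2R\<lparr>carrier := \<Gamma>\<rparr>) PSL2R_act)"

text \<open>
  The charts of \<open>\<Gamma>\H\<^sup>2\<close> are the local inverses of the projection from the upper half-plane, and
  their transition maps are the elements of \<open>\<Gamma>\<close>. A tangent vector of \<open>\<Gamma>\H\<^sup>2\<close> is therefore a
  class of pairs (coordinate, vector) modulo the differentials of the elements of \<open>\<Gamma>\<close>.
\<close>

definition T1_surface :: "(real^2^2) set set \<Rightarrow> (complex \<times> complex) set set" where
  "T1_surface \<Gamma> = orbits (PSL2R\<lparr>carrier := \<Gamma>\<rparr>) T1_upper_half_plane PSL2R_tangent_act"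


section \<open>The space \<open>\<Gamma>\PSL(2,\<real>)\<close> and the geodesic flow\<close>

text \<open>The points of \<open>\<Gamma>\PSL(2,\<real>)\<close> are the elements of \<^term>\<open>rcosets\<^bsub>PSL2R\<^esub> \<Gamma>\<close>. The choice of
  representatives below is immaterial, see lemma \<open>coset_dist_eq\<close>.\<close>

definition coset_dist :: "(real^2^2) set set \<Rightarrow>
    (real^2^2) set set \<Rightarrow> (real^2^2) set set \<Rightarrow> real" where
  "coset_dist \<Gamma> C D = (INF \<gamma>\<in>\<Gamma>. PSL2R_dist (SOME g. g \<in> C) (\<gamma> \<otimes>\<^bsub>PSL2R\<^esub> (SOME h. h \<in> D)))"

definition coset_flow :: "real \<Rightarrow> (real^2^2) set set \<Rightarrow> (real^2^2) set set" where
  "coset_flow t C = C #>\<^bsub>PSL2R\<^esub> PSL2R_diag t"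

text \<open>
  \<open>Xi_inv\<close> sends \<open>\<Gamma>g\<close> to the class of \<open>g \<cdot> (\<i>, \<i>)\<close>, where \<open>(\<i>, \<i>)\<close> is the vertical unit vector
  at \<open>\<i>\<close>; the image of the coset \<open>\<Gamma>g\<close> is exactly that class, see lemma \<open>Xi_inv_coset\<close>.
\<close>

definition Xi_inv :: "(real^2^2) set set \<Rightarrow> (complex \<times> complex) set" where
  "Xi_inv C = (\<lambda>g. PSL2R_tangent_act g (\<i>, \<i>)) ` C"

definition Xi :: "(real^2^2) set set \<Rightarrow> (complex \<times> complex) set \<Rightarrow> (real^2^2) set set" where
  "Xi \<Gamma> = the_inv_into (rcosets\<^bsub>PSL2R\<^esub> \<Gamma>) Xi_inv"

definition T1_dist :: "(real^2^2) set set \<Rightarrow>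
    (complex \<times> complex) set \<Rightarrow> (complex \<times> complex) set \<Rightarrow> real" where
  "T1_dist \<Gamma> u v = coset_dist \<Gamma> (Xi \<Gamma> u) (Xi \<Gamma> v)"

definition geodesic_flow :: "(real^2^2) set set \<Rightarrow>
    real \<Rightarrow> (complex \<times> complex) set \<Rightarrow> (complex \<times> complex) set" where
  "geodesic_flow \<Gamma> t = Xi_inv \<circ> coset_flow t \<circ> Xi \<Gamma>"


section \<open>Separating flows\<close>

text \<open>The separation conditions proper, for a flow \<open>\<phi>\<close> on \<open>M\<close> with distance \<open>d\<close>.\<close>

definition positive_separating ::
    "'a set \<Rightarrow> ('a \<Rightarrow> 'a \<Rightarrow> real) \<Rightarrow> (real \<Rightarrow> 'a \<Rightarrow> 'a) \<Rightarrow> bool" where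
  "positive_separating M d \<phi> \<longleftrightarrow> (\<exists>\<delta>>0. \<forall>x\<in>M. \<forall>y\<in>M.
     (\<forall>t\<ge>0. d (\<phi> t x) (\<phi> t y) < \<delta>) \<longrightarrow> (\<exists>\<tau>. y = \<phi> \<tau> x))"

definition negative_separating ::
    "'a set \<Rightarrow> ('a \<Rightarrow> 'a \<Rightarrow> real) \<Rightarrow> (real \<Rightarrow> 'a \<Rightarrow> 'a) \<Rightarrow> bool" where
  "negative_separating M d \<phi> \<longleftrightarrow> (\<exists>\<delta>>0. \<forall>x\<in>M. \<forall>y\<in>M.
     (\<forall>t\<le>0. d (\<phi> t x) (\<phi> t y) < \<delta>) \<longrightarrow> (\<exists>\<tau>. y = \<phi> \<tau> x))"


section \<open>Well-definedness and normalization\<close>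


lemma minus_matrix_mult:
  fixes A B :: "real^2^2"
  shows "(- A) ** B = - (A ** B)" "A ** (- B) = - (A ** B)"
  by (simp_all add: vec_eq_iff matrix_matrix_mult_def sum_negf)

lemma det_minus_2: "det (- A) = det (A :: real^2^2)"
  by (simp add: det_2)

lemma carrier_SL2R: "A \<in> carrier SL2R \<longleftrightarrow> det A = 1"
  by (simp add: SL2R_def)

lemma SL2R_simps: "A \<otimes>\<^bsub>SL2R\<^esub> B = A ** B" "\<one>\<^bsub>SL2R\<^esub> = mat 1"
  by (simp_all add: SL2R_def)

lemma matrix_inv_SL2R:
  assumes "det (A :: real^2^2) = 1"
  shows "A ** matrix_inv A = mat 1" "matrix_inv A ** A = mat 1" "det (matrix_inv A) = 1"
proof -
  have inv: "invertible A"
    using assms by (simp add: invertible_det_nz)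
  then show "A ** matrix_inv A = mat 1" and *: "matrix_inv A ** A = mat 1"
    unfolding matrix_inv_def invertible_def by (metis (mono_tags, lifting) someI_ex)+
  show "det (matrix_inv A) = 1"
    using arg_cong[OF *, of det] assms by (simp add: det_mul)
qed

lemma group_SL2R: "group SL2R"
proof (rule groupI)
  fix A assume "A \<in> carrier SL2R"
  then show "\<exists>B\<in>carrier SL2R. B \<otimes>\<^bsub>SL2R\<^esub> A = \<one>\<^bsub>SL2R\<^esub>"
    using matrix_inv_SL2R[of A] by (auto simp: carrier_SL2R SL2R_simps)
qed (auto simp: carrier_SL2R SL2R_simps det_mul matrix_mul_assoc)

interpretation SL2R: group SL2R by (rule group_SL2R)

lemma inv_SL2R: "det A = 1 \<Longrightarrow> inv\<^bsub>SL2R\<^esub> A = matrix_inv A"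
  by (rule SL2R.inv_equality) (auto simp: carrier_SL2R SL2R_simps matrix_inv_SL2R)

lemma normal_SL2R_center: "SL2R_center \<lhd> SL2R"
proof -
  have sub: "subgroup SL2R_center SL2R"
  proof (rule SL2R.subgroupI)
    show "SL2R_center \<subseteq> carrier SL2R"
      by (auto simp: SL2R_center_def carrier_SL2R det_minus_2)
    show "inv\<^bsub>SL2R\<^esub> A \<in> SL2R_center" if "A \<in> SL2R_center" for A
    proof -
      have "inv\<^bsub>SL2R\<^esub> A = A"
        using that by (intro SL2R.inv_equality)
          (auto simp: SL2R_center_def carrier_SL2R det_minus_2 SL2R_simps minus_matrix_mult)
      with that show ?thesis by simp
    qed
  qed (auto simp: SL2R_center_def SL2R_simps minus_matrix_mult)
  show ?thesis
  proof (rule SL2R.normal_invI[OF sub])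
    fix A H assume "A \<in> carrier SL2R" "H \<in> SL2R_center"
    then show "A \<otimes>\<^bsub>SL2R\<^esub> H \<otimes>\<^bsub>SL2R\<^esub> inv\<^bsub>SL2R\<^esub> A \<in> SL2R_center"
      by (auto simp: SL2R_center_def carrier_SL2R SL2R_simps inv_SL2R minus_matrix_mult matrix_inv_SL2R)
  qed
qed

interpretation PSL2R: group PSL2R
  unfolding PSL2R_def by (rule normal.factorgroup_is_group[OF normal_SL2R_center])

lemma PSL2R_class_eq: "PSL2R_class A = {A, - A}"
  by (auto simp: PSL2R_class_def SL2R_center_def r_coset_def SL2R_simps minus_matrix_mult)

lemma carrier_PSL2R: "carrier PSL2R = PSL2R_class ` carrier SL2R"
  by (auto simp: PSL2R_def FactGroup_def RCOSETS_def PSL2R_class_def)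

lemma PSL2R_class_mult:
  assumes "det A = 1" "det B = 1"
  shows "PSL2R_class A \<otimes>\<^bsub>PSL2R\<^esub> PSL2R_class B = PSL2R_class (A ** B)"
  by (auto simp: PSL2R_def FactGroup_def PSL2R_class_eq set_mult_def SL2R_simps minus_matrix_mult)

lemma PSL2R_class_one: "\<one>\<^bsub>PSL2R\<^esub> = PSL2R_class (mat 1)"
  by (auto simp: PSL2R_def FactGroup_def PSL2R_class_eq SL2R_center_def)

lemma quotient_map_quotient_topology: "quotient_map T (quotient_topology T f) f"
proof -
  have "istopology (\<lambda>U. U \<subseteq> f ` topspace T \<and> openin T {x \<in> topspace T. f x \<in> U})"
    unfolding istopology_def
  proof (intro conjI allI impI)
    fix \<K> assume *: "\<forall>K\<in>\<K>. K \<subseteq> f ` topspace T \<and> openin T {x \<in> topspace T. f x \<in> K}"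
    have "{x \<in> topspace T. f x \<in> \<Union>\<K>} = (\<Union>K\<in>\<K>. {x \<in> topspace T. f x \<in> K})"
      by auto
    with * show "openin T {x \<in> topspace T. f x \<in> \<Union>\<K>}"
      by auto
  next
    fix S U
    assume *: "S \<subseteq> f ` topspace T \<and> openin T {x \<in> topspace T. f x \<in> S}"
      "U \<subseteq> f ` topspace T \<and> openin T {x \<in> topspace T. f x \<in> U}"
    have "{x \<in> topspace T. f x \<in> S \<inter> U} =
        {x \<in> topspace T. f x \<in> S} \<inter> {x \<in> topspace T. f x \<in> U}"
      by auto
    with * show "openin T {x \<in> topspace T. f x \<in> S \<inter> U}"
      by auto
  qed auto
  then have op: "openin (quotient_topology T f) U \<longleftrightarrow>
      U \<subseteq> f ` topspace T \<and> openin T {x \<in> topspace T. f x \<in> U}" for U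
    by (simp add: quotient_topology_def)
  have "{x \<in> topspace T. f x \<in> f ` topspace T} = topspace T" by auto
  then have "openin (quotient_topology T f) (f ` topspace T)"
    by (simp add: op)
  then have "topspace (quotient_topology T f) = f ` topspace T"
    using op by (auto simp: topspace_def)
  then show ?thesis
    by (auto simp: quotient_map_def op)
qed

lemma SL2R_act_minus: "SL2R_act (- A) = SL2R_act A"
proof
  fix z
  have "moebius (- a) (- b) (- c) (- d) z = moebius a b c d z" for a b c d :: complex
  proof -
    have "moebius (- a) (- b) (- c) (- d) z = (- (a*z+b)) / (- (c*z+d))"
      by (simp add: moebius_def algebra_simps)
    then show ?thesis by (simp only: minus_divide_divide moebius_def)
  qed
  then show "SL2R_act (- A) z = SL2R_act A z"
    by (simp add: SL2R_act_def)
qed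

lemma PSL2R_act_class: "PSL2R_act (PSL2R_class A) = SL2R_act A"
  by (simp add: PSL2R_act_def PSL2R_class_eq SL2R_act_minus)

abbreviation (input) act_denom :: "real^2^2 \<Rightarrow> complex \<Rightarrow> complex" where
  "act_denom A z \<equiv> of_real (A$2$1) * z + of_real (A$2$2)"

lemma act_denom_nonzero:
  assumes "det A = 1" "Im z > 0"
  shows "act_denom A z \<noteq> 0"
proof
  assume *: "act_denom A z = 0"
  then have "A$2$1 * Im z = 0" "A$2$1 * Re z + A$2$2 = 0"
    by (auto simp: complex_eq_iff)
  with assms show False by (auto simp: det_2)
qed

lemma deriv_SL2R_act:
  assumes "det A = 1" "Im z > 0"
  shows "deriv (SL2R_act A) z = 1 / (act_denom A z)\<^sup>2"
proof (rule DERIV_imp_deriv)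
  have *: "of_real (A$1$1) * of_real (A$2$2) - of_real (A$1$2) * of_real (A$2$1) = (1::complex)"
    using assms(1) unfolding det_2 by (metis of_real_1 of_real_diff of_real_mult)
  show "(SL2R_act A has_field_derivative 1 / (act_denom A z)\<^sup>2) (at z)"
    unfolding SL2R_act_def moebius_def
    apply (rule derivative_eq_intros refl act_denom_nonzero[OF assms])+
    using act_denom_nonzero[OF assms] *
    by (simp add: field_simps power2_eq_square) (algebra)
qed

lemma PSL2R_tangent_act_class:
  assumes "det A = 1" "Im z > 0"
  shows "PSL2R_tangent_act (PSL2R_class A) (z, v) = (SL2R_act A z, v / (act_denom A z)\<^sup>2)"
  using assms by (simp add: PSL2R_tangent_act_def PSL2R_act_class deriv_SL2R_act)

lemma SL2R_act_mult:
  assumes "det A = 1" "det B = 1" "Im z > 0"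
  shows "act_denom (A ** B) z = act_denom A (SL2R_act B z) * act_denom B z"
    and "SL2R_act (A ** B) z = SL2R_act A (SL2R_act B z)"
proof -
  have nz: "act_denom B z \<noteq> 0" by (rule act_denom_nonzero[OF assms(2,3)])
  have eq: "SL2R_act B z * act_denom B z = of_real (B$1$1) * z + of_real (B$1$2)"
    using nz by (simp add: SL2R_act_def moebius_def)
  have *: "(a * SL2R_act B z + b) * act_denom B z =
      a * (of_real (B$1$1) * z + of_real (B$1$2)) + b * act_denom B z" for a b
    by (simp only: eq[symmetric]) (simp add: algebra_simps)
  show d: "act_denom (A ** B) z = act_denom A (SL2R_act B z) * act_denom B z"
    unfolding * by (simp add: matrix_matrix_mult_def sum_2 algebra_simps)
  have n: "of_real ((A ** B)$1$1) * z + of_real ((A ** B)$1$2) =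
    (of_real (A$1$1) * SL2R_act B z + of_real (A$1$2)) * act_denom B z"
    unfolding * by (simp add: matrix_matrix_mult_def sum_2 algebra_simps)
  show "SL2R_act (A ** B) z = SL2R_act A (SL2R_act B z)"
    using nz n d by (simp add: SL2R_act_def[of A] SL2R_act_def[of "A ** B"] moebius_def)
qed

lemma Im_SL2R_act:
  assumes "det A = 1" "Im z > 0"
  shows "Im (SL2R_act A z) = Im z / (cmod (act_denom A z))\<^sup>2"
proof -
  define N where "N = of_real (A$1$1) * z + of_real (A$1$2)"
  have "Im (SL2R_act A z) = Im (N * cnj (act_denom A z)) / (cmod (act_denom A z))\<^sup>2"
    unfolding SL2R_act_def moebius_def N_def
    by (subst complex_div_cnj) (simp add: Im_divide_of_real flip: of_real_power)
  also have "Im (N * cnj (act_denom A z)) = det A * Im z"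
    by (simp add: N_def det_2 algebra_simps)
  finally show ?thesis using assms by simp
qed

lemma PSL2R_tangent_act_mult:
  assumes "g \<in> carrier PSL2R" "h \<in> carrier PSL2R" "u \<in> T1_upper_half_plane"
  shows "PSL2R_tangent_act (g \<otimes>\<^bsub>PSL2R\<^esub> h) u = PSL2R_tangent_act g (PSL2R_tangent_act h u)"
proof -
  obtain A B z v where *: "g = PSL2R_class A" "det A = 1" "h = PSL2R_class B" "det B = 1"
    "u = (z, v)" "Im z > 0"
    using assms by (auto simp: carrier_PSL2R carrier_SL2R T1_upper_half_plane_def upper_half_plane_def)
  have "Im (SL2R_act B z) > 0"
    using * act_denom_nonzero[of B z] by (simp add: Im_SL2R_act)
  then show ?thesis using *
    by (simp add: PSL2R_class_mult PSL2R_tangent_act_class det_mul SL2R_act_mult power_mult_distrib)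
qed

lemma PSL2R_tangent_act_in:
  assumes "g \<in> carrier PSL2R" "u \<in> T1_upper_half_plane"
  shows "PSL2R_tangent_act g u \<in> T1_upper_half_plane"
proof -
  obtain A z v where *: "g = PSL2R_class A" "det A = 1" "u = (z, v)" "Im z > 0" "cmod v / Im z = 1"
    using assms by (auto simp: carrier_PSL2R carrier_SL2R T1_upper_half_plane_def upper_half_plane_def)
  then show ?thesis
    using act_denom_nonzero[of A z]
    by (simp add: T1_upper_half_plane_def upper_half_plane_def PSL2R_tangent_act_class Im_SL2R_act
        norm_divide norm_power)
qed

lemma base_vector: "(\<i>, \<i>) \<in> T1_upper_half_plane"
  by (simp add: T1_upper_half_plane_def upper_half_plane_def)

lemma PSL2R_simply_transitive:
  assumes "u \<in> T1_upper_half_plane"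
  shows "\<exists>!g. g \<in> carrier PSL2R \<and> PSL2R_tangent_act g (\<i>, \<i>) = u"
proof (rule ex_ex1I)
  obtain z v where u: "u = (z, v)" and z: "Im z > 0" and v: "cmod v = Im z"
    using assms by (auto simp: T1_upper_half_plane_def upper_half_plane_def)
  define w where "w = csqrt (\<i> / v)"
  have v0: "v \<noteq> 0" using z v by auto
  have w2: "w\<^sup>2 = \<i> / v" by (simp add: w_def)
  then have w0: "w \<noteq> 0" using v0 by auto
  have "(cmod w)\<^sup>2 = cmod (\<i> / v)" by (metis norm_power w2)
  then have nw: "(Re w)\<^sup>2 + (Im w)\<^sup>2 = 1 / Im z"
    using v by (simp add: norm_divide cmod_power2)
  define A :: "real^2^2" where "A = vector [vector [Im (z * w), Re (z * w)], vector [Im w, Re w]]"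
  have "det A = Im z * ((Re w)\<^sup>2 + (Im w)\<^sup>2)"
    by (simp add: det_2 A_def algebra_simps power2_eq_square)
  also have "\<dots> = 1" using nw z by simp
  finally have detA: "det A = 1" .
  have d: "act_denom A \<i> = w" and n: "of_real (A$1$1) * \<i> + of_real (A$1$2) = z * w"
    by (simp_all add: A_def complex_eq_iff)
  have "SL2R_act A \<i> = z"
    using d n w0 by (simp add: SL2R_act_def moebius_def)
  then have "PSL2R_tangent_act (PSL2R_class A) (\<i>, \<i>) = u"
    using detA d w2 v0 by (simp add: PSL2R_tangent_act_class u)
  then show "\<exists>g. g \<in> carrier PSL2R \<and> PSL2R_tangent_act g (\<i>, \<i>) = u"
    using detA by (auto simp: carrier_PSL2R carrier_SL2R)
next
  fix g h
  assume "g \<in> carrier PSL2R \<and> PSL2R_tangent_act g (\<i>, \<i>) = u"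
    and "h \<in> carrier PSL2R \<and> PSL2R_tangent_act h (\<i>, \<i>) = u"
  then obtain A B where A: "det A = 1" "g = PSL2R_class A" and B: "det B = 1" "h = PSL2R_class B"
    and eq: "PSL2R_tangent_act (PSL2R_class A) (\<i>, \<i>) = PSL2R_tangent_act (PSL2R_class B) (\<i>, \<i>)"
    by (auto simp: carrier_PSL2R carrier_SL2R)
  have nz: "act_denom A \<i> \<noteq> 0" "act_denom B \<i> \<noteq> 0"
    using A B by (simp_all add: act_denom_nonzero del: of_real_eq_0_iff)
  have act: "SL2R_act A \<i> = SL2R_act B \<i>" and "\<i> / (act_denom A \<i>)\<^sup>2 = \<i> / (act_denom B \<i>)\<^sup>2"
    using eq A B by (simp_all add: PSL2R_tangent_act_class)
  then have "(act_denom A \<i>)\<^sup>2 = (act_denom B \<i>)\<^sup>2"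
    using nz by (simp add: frac_eq_eq)
  then have "act_denom A \<i> = act_denom B \<i> \<or> act_denom A \<i> = - act_denom B \<i>"
    by (simp only: power2_eq_iff)
  then have "A = B \<or> A = - B"
  proof
    assume d: "act_denom A \<i> = act_denom B \<i>"
    then have "of_real (A$1$1) * \<i> + of_real (A$1$2) = of_real (B$1$1) * \<i> + of_real (B$1$2)"
      using act nz by (simp add: SL2R_act_def moebius_def)
    with d have "A = B"
      by (simp add: complex_eq_iff vec_eq_iff forall_2)
    then show ?thesis ..
  next
    assume d: "act_denom A \<i> = - act_denom B \<i>"
    have "(of_real (A$1$1) * \<i> + of_real (A$1$2)) / act_denom A \<i> =
        - (of_real (B$1$1) * \<i> + of_real (B$1$2)) / act_denom A \<i>"
      using act unfolding d SL2R_act_def moebius_def by (simp only: minus_divide_divide d)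
    then have "of_real (A$1$1) * \<i> + of_real (A$1$2) = - (of_real (B$1$1) * \<i> + of_real (B$1$2))"
      using nz by (metis divide_cancel_right)
    with d have "A = - B"
      by (simp add: complex_eq_iff vec_eq_iff forall_2)
    then show ?thesis ..
  qed
  then show "g = h"
    using A B by (auto simp: PSL2R_class_eq)
qed

lemma Xi_inv_coset:
  assumes "subgroup \<Gamma> PSL2R" "g \<in> carrier PSL2R"
  shows "Xi_inv (\<Gamma> #>\<^bsub>PSL2R\<^esub> g) =
    orbit (PSL2R\<lparr>carrier := \<Gamma>\<rparr>) PSL2R_tangent_act (PSL2R_tangent_act g (\<i>, \<i>))"
proof -
  have *: "PSL2R_tangent_act (\<gamma> \<otimes>\<^bsub>PSL2R\<^esub> g) (\<i>, \<i>) =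
      PSL2R_tangent_act \<gamma> (PSL2R_tangent_act g (\<i>, \<i>))" if "\<gamma> \<in> \<Gamma>" for \<gamma>
    using PSL2R_tangent_act_mult[OF subgroup.mem_carrier[OF assms(1) that] assms(2) base_vector] .
  have "\<Gamma> #>\<^bsub>PSL2R\<^esub> g = (\<lambda>\<gamma>. \<gamma> \<otimes>\<^bsub>PSL2R\<^esub> g) ` \<Gamma>"
    by (auto simp: r_coset_def)
  then have "Xi_inv (\<Gamma> #>\<^bsub>PSL2R\<^esub> g) =
      (\<lambda>\<gamma>. PSL2R_tangent_act \<gamma> (PSL2R_tangent_act g (\<i>, \<i>))) ` \<Gamma>"
    by (simp add: Xi_inv_def image_image * cong: image_cong)
  then show ?thesis
    by (auto simp: orbit_def)
qed

lemma bij_betw_Xi_inv: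
  assumes "subgroup \<Gamma> PSL2R"
  shows "bij_betw Xi_inv (rcosets\<^bsub>PSL2R\<^esub> \<Gamma>) (T1_surface \<Gamma>)"
proof -
  have sub: "\<gamma> \<in> carrier PSL2R" if "\<gamma> \<in> \<Gamma>" for \<gamma>
    using subgroup.mem_carrier[OF assms(1) that] .
  have inj: "inj_on (\<lambda>g. PSL2R_tangent_act g (\<i>, \<i>)) (carrier PSL2R)"
    using PSL2R_simply_transitive PSL2R_tangent_act_in[OF _ base_vector]
    by (intro inj_onI) blast
  have "inj_on Xi_inv (rcosets\<^bsub>PSL2R\<^esub> \<Gamma>)"
  proof (rule inj_onI)
    fix C D assume "C \<in> rcosets\<^bsub>PSL2R\<^esub> \<Gamma>" "D \<in> rcosets\<^bsub>PSL2R\<^esub> \<Gamma>" "Xi_inv C = Xi_inv D"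
    moreover have "C \<subseteq> carrier PSL2R" if "C \<in> rcosets\<^bsub>PSL2R\<^esub> \<Gamma>" for C
      using that sub by (auto simp: RCOSETS_def r_coset_def)
    ultimately show "C = D"
      using inj_on_image_eq_iff[OF inj] by (auto simp: Xi_inv_def)
  qed
  moreover have "Xi_inv ` (rcosets\<^bsub>PSL2R\<^esub> \<Gamma>) = T1_surface \<Gamma>"
  proof -
    have "Xi_inv ` (rcosets\<^bsub>PSL2R\<^esub> \<Gamma>) = (\<lambda>g. orbit (PSL2R\<lparr>carrier := \<Gamma>\<rparr>) PSL2R_tangent_act
        (PSL2R_tangent_act g (\<i>, \<i>))) ` carrier PSL2R"
      by (auto simp: RCOSETS_def Xi_inv_coset assms image_iff)
    also have "\<dots> = orbit (PSL2R\<lparr>carrier := \<Gamma>\<rparr>) PSL2R_tangent_act `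
        ((\<lambda>g. PSL2R_tangent_act g (\<i>, \<i>)) ` carrier PSL2R)"
      by (simp add: image_image)
    also have "(\<lambda>g. PSL2R_tangent_act g (\<i>, \<i>)) ` carrier PSL2R = T1_upper_half_plane"
      using PSL2R_simply_transitive PSL2R_tangent_act_in[OF _ base_vector] by (auto simp: image_iff) metis+
    finally show ?thesis
      by (auto simp: T1_surface_def orbits_def)
  qed
  ultimately show ?thesis
    by (simp add: bij_betw_def)
qed


subsection \<open>Distances\<close>

lemma bounded_linear_matrix_mult: "bounded_linear ((**) (K :: real^2^2))"
  by (intro linear_conv_bounded_linear[THEN iffD1] linearI)
    (simp_all add: vec_eq_iff matrix_matrix_mult_def sum_distrib_left sum.distrib algebra_simps)

lemma matrix_inv_eqI: "A ** B = mat 1 \<Longrightarrow> B ** A = mat 1 \<Longrightarrow> matrix_inv A = (B :: real^2^2)"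
  unfolding matrix_inv_def
  by (rule some_equality) (auto, metis matrix_mul_assoc matrix_mul_rid)

lemma PSL2R_lengths_left_mono:
  assumes "k \<in> carrier PSL2R" "g \<in> carrier PSL2R" "h \<in> carrier PSL2R"
  shows "PSL2R_lengths g h \<subseteq> PSL2R_lengths (k \<otimes>\<^bsub>PSL2R\<^esub> g) (k \<otimes>\<^bsub>PSL2R\<^esub> h)"
proof
  obtain K where K: "k = PSL2R_class K" "det K = 1"
    using assms(1) by (auto simp: carrier_PSL2R carrier_SL2R)
  have mult: "K ** A \<in> k \<otimes>\<^bsub>PSL2R\<^esub> l" if "A \<in> l" "l \<in> carrier PSL2R" for A l
    using that K by (auto simp: carrier_PSL2R carrier_SL2R PSL2R_class_mult)
      (auto simp: PSL2R_class_eq minus_matrix_mult)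
  fix L assume "L \<in> PSL2R_lengths g h"
  then obtain p where p: "p piecewise_C1_differentiable_on {0..1}" "p ` {0..1} \<subseteq> carrier SL2R"
      "p 0 \<in> g" "p 1 \<in> h"
    and L: "((\<lambda>t. norm (matrix_inv (p t) ** vector_derivative p (at t))) has_integral L) {0..1}"
    unfolding PSL2R_lengths_def by blast
  from p(1) obtain S D where cont: "continuous_on {0..1} p" and S: "finite S"
    and D: "\<And>t. t \<in> {0..1} - S \<Longrightarrow> (p has_vector_derivative D t) (at t)"
    and contD: "continuous_on ({0..1} - S) D"
    unfolding piecewise_C1_differentiable_on_def C1_differentiable_on_def by blast
  define q where "q = (\<lambda>t. K ** p t)"
  have Dq: "(q has_vector_derivative K ** D t) (at t)" if "t \<in> {0..1} - S" for t
    unfolding q_def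
    by (rule bounded_linear.has_vector_derivative[OF bounded_linear_matrix_mult D[OF that]])
  have "continuous_on {0..1} q" "continuous_on ({0..1} - S) (\<lambda>t. K ** D t)"
    unfolding q_def
    by (rule bounded_linear.continuous_on[OF bounded_linear_matrix_mult cont]
        bounded_linear.continuous_on[OF bounded_linear_matrix_mult contD])+
  with S Dq have "q piecewise_C1_differentiable_on {0..1}"
    unfolding piecewise_C1_differentiable_on_def C1_differentiable_on_def
    by (intro conjI exI[of _ S] exI[of _ "\<lambda>t. K ** D t"]) auto
  moreover have "q ` {0..1} \<subseteq> carrier SL2R"
    using p(2) K by (auto simp: q_def carrier_SL2R det_mul image_subset_iff)
  moreover have "q 0 \<in> k \<otimes>\<^bsub>PSL2R\<^esub> g" "q 1 \<in> k \<otimes>\<^bsub>PSL2R\<^esub> h"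
    using p assms by (auto simp: q_def mult)
  moreover have "((\<lambda>t. norm (matrix_inv (q t) ** vector_derivative q (at t))) has_integral L) {0..1}"
  proof (rule has_integral_spike_finite[OF S _ L])
    fix t assume t: "t \<in> {0..1} - S"
    then have pt: "det (p t) = 1"
      using p(2) by (auto simp: carrier_SL2R image_subset_iff)
    have "matrix_inv (q t) = matrix_inv (p t) ** matrix_inv K"
      unfolding q_def
    proof (rule matrix_inv_eqI)
      have "K ** p t ** (matrix_inv (p t) ** matrix_inv K) =
          K ** (p t ** matrix_inv (p t)) ** matrix_inv K"
        by (simp only: matrix_mul_assoc)
      then show "K ** p t ** (matrix_inv (p t) ** matrix_inv K) = mat 1"
        using pt K by (simp add: matrix_inv_SL2R)
      have "matrix_inv (p t) ** matrix_inv K ** (K ** p t) =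
          matrix_inv (p t) ** (matrix_inv K ** K) ** p t"
        by (simp only: matrix_mul_assoc)
      then show "matrix_inv (p t) ** matrix_inv K ** (K ** p t) = mat 1"
        using pt K by (simp add: matrix_inv_SL2R)
    qed
    then have "matrix_inv (q t) ** (K ** D t) = matrix_inv (p t) ** (matrix_inv K ** K) ** D t"
      by (simp add: matrix_mul_assoc)
    then have "matrix_inv (q t) ** (K ** D t) = matrix_inv (p t) ** D t"
      using K by (simp add: matrix_inv_SL2R)
    then show "norm (matrix_inv (q t) ** vector_derivative q (at t)) =
        norm (matrix_inv (p t) ** vector_derivative p (at t))"
      using D[OF t] Dq[OF t] by (simp add: vector_derivative_at)
  qed
  ultimately show "L \<in> PSL2R_lengths (k \<otimes>\<^bsub>PSL2R\<^esub> g) (k \<otimes>\<^bsub>PSL2R\<^esub> h)"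
    unfolding PSL2R_lengths_def by blast
qed

lemma PSL2R_dist_left_invariant:
  assumes "k \<in> carrier PSL2R" "g \<in> carrier PSL2R" "h \<in> carrier PSL2R"
  shows "PSL2R_dist (k \<otimes>\<^bsub>PSL2R\<^esub> g) (k \<otimes>\<^bsub>PSL2R\<^esub> h) = PSL2R_dist g h"
proof -
  have "PSL2R_lengths (k \<otimes>\<^bsub>PSL2R\<^esub> g) (k \<otimes>\<^bsub>PSL2R\<^esub> h) \<subseteq>
      PSL2R_lengths (inv\<^bsub>PSL2R\<^esub> k \<otimes>\<^bsub>PSL2R\<^esub> (k \<otimes>\<^bsub>PSL2R\<^esub> g)) (inv\<^bsub>PSL2R\<^esub> k \<otimes>\<^bsub>PSL2R\<^esub> (k \<otimes>\<^bsub>PSL2R\<^esub> h))"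
    using assms by (intro PSL2R_lengths_left_mono) auto
  also have "\<dots> = PSL2R_lengths g h"
    using assms by (simp flip: PSL2R.m_assoc)
  finally show ?thesis
    using PSL2R_lengths_left_mono[OF assms] by (simp add: PSL2R_dist_def)
qed

lemma coset_dist_eq:
  assumes "subgroup \<Gamma> PSL2R" "g \<in> carrier PSL2R" "h \<in> carrier PSL2R"
  shows "coset_dist \<Gamma> (\<Gamma> #>\<^bsub>PSL2R\<^esub> g) (\<Gamma> #>\<^bsub>PSL2R\<^esub> h) =
    (INF \<gamma>\<in>\<Gamma>. PSL2R_dist g (\<gamma> \<otimes>\<^bsub>PSL2R\<^esub> h))"
proof -
  interpret \<Gamma>: subgroup \<Gamma> PSL2R by fact
  have some: "\<exists>\<gamma>\<in>\<Gamma>. (SOME l. l \<in> \<Gamma> #>\<^bsub>PSL2R\<^esub> k) = \<gamma> \<otimes>\<^bsub>PSL2R\<^esub> k" if "k \<in> carrier PSL2R" for k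
  proof -
    have "(SOME l. l \<in> \<Gamma> #>\<^bsub>PSL2R\<^esub> k) \<in> \<Gamma> #>\<^bsub>PSL2R\<^esub> k"
      by (rule someI[of _ k]) (rule PSL2R.rcos_self[OF that assms(1)])
    then show ?thesis by (auto simp: r_coset_def)
  qed
  obtain \<alpha> \<beta> where ab: "\<alpha> \<in> \<Gamma>" "\<beta> \<in> \<Gamma>"
    and eq: "(SOME l. l \<in> \<Gamma> #>\<^bsub>PSL2R\<^esub> g) = \<alpha> \<otimes>\<^bsub>PSL2R\<^esub> g" "(SOME l. l \<in> \<Gamma> #>\<^bsub>PSL2R\<^esub> h) = \<beta> \<otimes>\<^bsub>PSL2R\<^esub> h"
    using some assms by metis
  have *: "PSL2R_dist (\<alpha> \<otimes>\<^bsub>PSL2R\<^esub> g) (\<alpha> \<otimes>\<^bsub>PSL2R\<^esub> \<gamma> \<otimes>\<^bsub>PSL2R\<^esub> h) = PSL2R_dist g (\<gamma> \<otimes>\<^bsub>PSL2R\<^esub> h)"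
    if "\<gamma> \<in> \<Gamma>" for \<gamma>
    using PSL2R_dist_left_invariant[of \<alpha> g "\<gamma> \<otimes>\<^bsub>PSL2R\<^esub> h"] that ab assms
    by (simp add: PSL2R.m_assoc)
  have "(\<lambda>\<gamma>. PSL2R_dist (\<alpha> \<otimes>\<^bsub>PSL2R\<^esub> g) (\<gamma> \<otimes>\<^bsub>PSL2R\<^esub> (\<beta> \<otimes>\<^bsub>PSL2R\<^esub> h))) ` \<Gamma> =
      (\<lambda>\<gamma>. PSL2R_dist g (\<gamma> \<otimes>\<^bsub>PSL2R\<^esub> h)) ` \<Gamma>"
  proof (intro equalityI image_subsetI)
    fix \<gamma> assume \<gamma>: "\<gamma> \<in> \<Gamma>"
    define \<delta> where "\<delta> = inv\<^bsub>PSL2R\<^esub> \<alpha> \<otimes>\<^bsub>PSL2R\<^esub> (\<gamma> \<otimes>\<^bsub>PSL2R\<^esub> \<beta>)"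
    have \<delta>: "\<delta> \<in> \<Gamma>" using \<gamma> ab by (simp add: \<delta>_def)
    have "\<alpha> \<otimes>\<^bsub>PSL2R\<^esub> \<delta> = \<gamma> \<otimes>\<^bsub>PSL2R\<^esub> \<beta>"
      using \<gamma> ab unfolding \<delta>_def by (simp flip: PSL2R.m_assoc)
    then have "\<gamma> \<otimes>\<^bsub>PSL2R\<^esub> (\<beta> \<otimes>\<^bsub>PSL2R\<^esub> h) = \<alpha> \<otimes>\<^bsub>PSL2R\<^esub> \<delta> \<otimes>\<^bsub>PSL2R\<^esub> h"
      using \<gamma> ab assms by (simp add: PSL2R.m_assoc)
    then show "PSL2R_dist (\<alpha> \<otimes>\<^bsub>PSL2R\<^esub> g) (\<gamma> \<otimes>\<^bsub>PSL2R\<^esub> (\<beta> \<otimes>\<^bsub>PSL2R\<^esub> h)) \<in>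
        (\<lambda>\<gamma>. PSL2R_dist g (\<gamma> \<otimes>\<^bsub>PSL2R\<^esub> h)) ` \<Gamma>"
      using *[OF \<delta>] \<delta> by simp
  next
    fix \<gamma> assume \<gamma>: "\<gamma> \<in> \<Gamma>"
    define \<delta> where "\<delta> = \<alpha> \<otimes>\<^bsub>PSL2R\<^esub> \<gamma> \<otimes>\<^bsub>PSL2R\<^esub> inv\<^bsub>PSL2R\<^esub> \<beta>"
    have \<delta>: "\<delta> \<in> \<Gamma>" using \<gamma> ab by (simp add: \<delta>_def)
    have "\<delta> \<otimes>\<^bsub>PSL2R\<^esub> \<beta> = \<alpha> \<otimes>\<^bsub>PSL2R\<^esub> \<gamma>"
      using \<gamma> ab unfolding \<delta>_def by (simp add: PSL2R.m_assoc)
    then have "\<delta> \<otimes>\<^bsub>PSL2R\<^esub> (\<beta> \<otimes>\<^bsub>PSL2R\<^esub> h) = \<alpha> \<otimes>\<^bsub>PSL2R\<^esub> \<gamma> \<otimes>\<^bsub>PSL2R\<^esub> h"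
      using \<gamma> \<delta> ab assms by (simp flip: PSL2R.m_assoc)
    then show "PSL2R_dist g (\<gamma> \<otimes>\<^bsub>PSL2R\<^esub> h) \<in>
        (\<lambda>\<gamma>. PSL2R_dist (\<alpha> \<otimes>\<^bsub>PSL2R\<^esub> g) (\<gamma> \<otimes>\<^bsub>PSL2R\<^esub> (\<beta> \<otimes>\<^bsub>PSL2R\<^esub> h))) ` \<Gamma>"
      using *[OF \<gamma>] \<delta> by (metis imageI)
  qed
  then show ?thesis
    by (simp add: coset_dist_def eq)
qed

lemma matrix_inv_SL2R_explicit:
  assumes "det (A :: real^2^2) = 1"
  shows "matrix_inv A = vector [vector [A$2$2, - (A$1$2)], vector [- (A$2$1), A$1$1]]"
  using assms
  by (intro matrix_inv_eqI)
    (auto simp: vec_eq_iff forall_2 matrix_matrix_mult_def sum_2 mat_def det_2 algebra_simps)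

lemma norm_matrix_2: "(norm (A :: real^2^2))\<^sup>2 = (A$1$1)\<^sup>2 + (A$1$2)\<^sup>2 + (A$2$1)\<^sup>2 + (A$2$2)\<^sup>2"
  by (simp add: norm_vec_def L2_set_def sum_2)

lemma traceless_quadratic_bound:
  fixes A :: "real^2^2"
  assumes "A$2$2 = - (A$1$1)"
  shows "2 * \<bar>A$1$1 * (x\<^sup>2 - y\<^sup>2) + (A$1$2 + A$2$1) * (x * y)\<bar> \<le> sqrt 2 * norm A * (x\<^sup>2 + y\<^sup>2)"
proof (rule power2_le_imp_le)
  define a b c where "a = A$1$1" and "b = A$1$2" and "c = A$2$1"
  have "(2 * (a * (x\<^sup>2 - y\<^sup>2) + (b + c) * (x * y)))\<^sup>2 \<le>
      2 * (2 * a\<^sup>2 + b\<^sup>2 + c\<^sup>2) * (x\<^sup>2 + y\<^sup>2)\<^sup>2"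
  proof -
    have "2 * (2 * a\<^sup>2 + b\<^sup>2 + c\<^sup>2) * (x\<^sup>2 + y\<^sup>2)\<^sup>2 -
        (2 * (a * (x\<^sup>2 - y\<^sup>2) + (b + c) * (x * y)))\<^sup>2 =
        (b - c)\<^sup>2 * (x\<^sup>2 + y\<^sup>2)\<^sup>2 + (4 * a * x * y - (b + c) * (x\<^sup>2 - y\<^sup>2))\<^sup>2"
      by (simp add: power2_eq_square algebra_simps)
    moreover have "\<dots> \<ge> 0" by simp
    ultimately show ?thesis by linarith
  qed
  also have "2 * a\<^sup>2 + b\<^sup>2 + c\<^sup>2 = (norm A)\<^sup>2"
    using assms by (simp add: norm_matrix_2 a_def b_def c_def)
  finally show "(2 * \<bar>A$1$1 * (x\<^sup>2 - y\<^sup>2) + (A$1$2 + A$2$1) * (x * y)\<bar>)\<^sup>2 \<le>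
      (sqrt 2 * norm A * (x\<^sup>2 + y\<^sup>2))\<^sup>2"
    by (simp only: a_def b_def c_def power_mult_distrib power2_abs real_sqrt_pow2 zero_le_numeral)
qed simp

lemma PSL2R_lengths_row_bound:
  assumes "L \<in> PSL2R_lengths g h"
  shows "\<exists>A\<in>g. \<exists>B\<in>h. \<bar>ln ((B$1$1)\<^sup>2 + (B$1$2)\<^sup>2) - ln ((A$1$1)\<^sup>2 + (A$1$2)\<^sup>2)\<bar> \<le> sqrt 2 * L"
proof -
  obtain p where p: "p piecewise_C1_differentiable_on {0..1}" "p ` {0..1} \<subseteq> carrier SL2R"
      "p 0 \<in> g" "p 1 \<in> h"
    and L: "((\<lambda>t. norm (matrix_inv (p t) ** vector_derivative p (at t))) has_integral L) {0..1}"
    using assms unfolding PSL2R_lengths_def by blast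
  from p(1) obtain S D where cont: "continuous_on {0..1} p" and S: "finite S"
    and D: "\<And>t. t \<in> {0..1} - S \<Longrightarrow> (p has_vector_derivative D t) (at t)"
    unfolding piecewise_C1_differentiable_on_def C1_differentiable_on_def by blast
  have det: "det (p t) = 1" if "t \<in> {0..1}" for t
    using p(2) that by (auto simp: carrier_SL2R image_subset_iff)
  define r where "r = (\<lambda>t. (p t$1$1)\<^sup>2 + (p t$1$2)\<^sup>2)"
  have r: "r t > 0" if "t \<in> {0..1}" for t
  proof -
    have "p t$1$1 \<noteq> 0 \<or> p t$1$2 \<noteq> 0" using det[OF that] by (auto simp: det_2)
    then show ?thesis by (auto simp: r_def sum_power2_gt_zero_iff)
  qed
  define r' where "r' = (\<lambda>t. 2 * (p t$1$1 * D t$1$1 + p t$1$2 * D t$1$2))"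
  have entry: "((\<lambda>t. p t$i$j) has_real_derivative D t$i$j) (at t)" if "t \<in> {0..1} - S" for t i j
  proof -
    have "bounded_linear (\<lambda>A :: real^2^2. A$i$j)"
      by (intro bounded_linear_vec_nth bounded_linear_compose[of "\<lambda>x. x$j"])
    from bounded_linear.has_vector_derivative[OF this D[OF that]] show ?thesis
      by (simp add: has_real_derivative_iff_has_vector_derivative)
  qed
  define f' where "f' = (\<lambda>t. if t \<in> insert 0 (insert 1 S) then 0 else r' t / r t)"
  have "(f' has_integral (ln (r 1) - ln (r 0))) {0..1}"
  proof (rule fundamental_theorem_of_calculus_interior_strong[OF S])
    fix t :: real assume t: "t \<in> {0<..<1} - S"
    then have t': "t \<in> {0..1}" "t \<in> {0..1} - S" by auto
    have "((\<lambda>t. ln (r t)) has_real_derivative r' t / r t) (at t)"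
      unfolding r_def r'_def using r[OF t'(1)] unfolding r_def
      by (auto intro!: derivative_eq_intros entry[OF t'(2)] simp: field_simps)
    then show "((\<lambda>t. ln (r t)) has_vector_derivative f' t) (at t)"
      using t by (simp add: f'_def has_real_derivative_iff_has_vector_derivative)
  next
    have "continuous_on {0..1} r"
      unfolding r_def by (intro continuous_intros cont)
    then show "continuous_on {0..1} (\<lambda>t. ln (r t))"
      using r by (intro continuous_on_ln) (auto simp: less_imp_neq[THEN not_sym])
  qed simp
  moreover have "((\<lambda>t. sqrt 2 * norm (matrix_inv (p t) ** vector_derivative p (at t)))
      has_integral (sqrt 2 * L)) {0..1}"
    by (rule has_integral_mult_right[OF L])
  moreover have "\<bar>f' t\<bar> \<le> sqrt 2 * norm (matrix_inv (p t) ** vector_derivative p (at t))"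
    if t: "t \<in> {0..1}" for t
  proof (cases "t \<in> insert 0 (insert 1 S)")
    case False
    with t have t': "t \<in> {0..1} - S" "t \<in> {0<..<1}" by auto
    define M where "M = matrix_inv (p t) ** D t"
    have M: "M$1$1 = p t$2$2 * D t$1$1 - p t$1$2 * D t$2$1" "M$1$2 = p t$2$2 * D t$1$2 - p t$1$2 * D t$2$2"
      "M$2$1 = p t$1$1 * D t$2$1 - p t$2$1 * D t$1$1" "M$2$2 = p t$1$1 * D t$2$2 - p t$2$1 * D t$1$2"
      unfolding M_def matrix_inv_SL2R_explicit[OF det[OF t]]
      by (simp_all add: matrix_matrix_mult_def sum_2)
    have "((\<lambda>t. det (p t)) has_real_derivative M$1$1 + M$2$2) (at t)"
      unfolding det_2 M
      by (auto intro!: derivative_eq_intros entry[OF t'(1)] simp: algebra_simps)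
    moreover have "((\<lambda>t. det (p t)) has_real_derivative 0) (at t)"
    proof (rule has_field_derivative_transform_within_open[of "\<lambda>_. 1" _ _ "{0<..<1}"])
      show "1 = det (p s)" if "s \<in> {0<..<1}" for s
        using that det[of s] by simp
    qed (use t' in auto)
    ultimately have tr: "M$2$2 = - (M$1$1)"
      using DERIV_unique by fastforce
    have D_eq: "D t = p t ** M"
      unfolding M_def using matrix_inv_SL2R(1)[OF det[OF t]]
      by (simp add: matrix_mul_assoc)
    have "r' t = 2 * (M$1$1 * ((p t$1$1)\<^sup>2 - (p t$1$2)\<^sup>2) + (M$1$2 + M$2$1) * (p t$1$1 * p t$1$2))"
      unfolding r'_def D_eq using tr
      by (simp add: matrix_matrix_mult_def sum_2 algebra_simps power2_eq_square)
    then have "\<bar>r' t\<bar> \<le> sqrt 2 * norm M * r t"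
      using traceless_quadratic_bound[OF tr, of "p t$1$1" "p t$1$2"]
      by (simp only: r_def abs_mult abs_numeral)
    then have "\<bar>r' t / r t\<bar> \<le> sqrt 2 * norm M"
      using r[OF t] by (simp add: field_simps)
    then show ?thesis
      using False by (simp add: f'_def M_def vector_derivative_at[OF D[OF t'(1)]])
  qed (simp add: f'_def)
  ultimately have "\<bar>ln (r 1) - ln (r 0)\<bar> \<le> sqrt 2 * L"
    by (metis (no_types, lifting) has_integral_iff integral_norm_bound_integral real_norm_def)
  then show ?thesis
    using p by (auto simp: r_def)
qed

lemma PSL2R_lengths_nonneg: "L \<in> PSL2R_lengths g h \<Longrightarrow> L \<ge> 0"
  unfolding PSL2R_lengths_def by (auto elim!: has_integral_nonneg)

lemma PSL2R_dist_diag: "PSL2R_dist (PSL2R_diag t) \<one>\<^bsub>PSL2R\<^esub> = \<bar>t\<bar> / sqrt 2"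
proof -
  have lower: "\<bar>t\<bar> / sqrt 2 \<le> L" if L: "L \<in> PSL2R_lengths (PSL2R_diag t) \<one>\<^bsub>PSL2R\<^esub>" for L
  proof -
    have "\<bar>t\<bar> \<le> sqrt 2 * L"
      using PSL2R_lengths_row_bound[OF L]
      by (auto simp: PSL2R_diag_def PSL2R_class_one PSL2R_class_eq mat_def exp_double[symmetric])
    then show ?thesis by (simp add: field_simps)
  qed
  define E where "E = (\<lambda>x. vector [vector [exp x, 0], vector [0, exp (- x)]] :: real^2^2)"
  define E' where "E' = (\<lambda>x. vector [vector [exp x, 0], vector [0, - exp (- x)]] :: real^2^2)"
  define p where "p = (\<lambda>s. E (t / 2 * (1 - s)))"
  have E_eq: "E x = exp x *\<^sub>R E 0 + (exp (- x) - exp x) *\<^sub>R vector [vector [0, 0], vector [0, 1]]" for x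
    by (simp add: E_def vec_eq_iff forall_2)
  have D: "(p has_vector_derivative (- t / 2) *\<^sub>R E' (t / 2 * (1 - s))) (at s)" for s
    unfolding p_def
    apply (subst E_eq)
    apply (rule derivative_eq_intros refl)+
    apply (simp add: E_def E'_def vec_eq_iff forall_2 algebra_simps)
    done
  have contE': "continuous_on UNIV (\<lambda>s. E' (t / 2 * (1 - s)))"
  proof -
    have "E' x = exp x *\<^sub>R vector [vector [1, 0], vector [0, 0]] -
        exp (- x) *\<^sub>R vector [vector [0, 0], vector [0, 1]]" for x
      by (simp add: E'_def vec_eq_iff forall_2)
    then show ?thesis by (auto intro!: continuous_intros)
  qed
  have "\<bar>t\<bar> / sqrt 2 \<in> PSL2R_lengths (PSL2R_diag t) \<one>\<^bsub>PSL2R\<^esub>"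
    unfolding PSL2R_lengths_def
  proof (intro CollectI exI conjI)
    show "p piecewise_C1_differentiable_on {0..1}"
      unfolding piecewise_C1_differentiable_on_def C1_differentiable_on_def
    proof (intro conjI exI ballI)
      show "continuous_on {0..1} p"
        by (intro continuous_at_imp_continuous_on ballI has_vector_derivative_continuous[OF D])
      show "continuous_on ({0..1} - {}) (\<lambda>s. (- t / 2) *\<^sub>R E' (t / 2 * (1 - s)))"
        by (intro continuous_intros continuous_on_subset[OF contE']) simp
    qed (rule finite.emptyI D)+
    show "p ` {0..1} \<subseteq> carrier SL2R"
      by (auto simp: p_def E_def carrier_SL2R det_2 simp flip: exp_add)
    show "p 0 \<in> PSL2R_diag t" "p 1 \<in> \<one>\<^bsub>PSL2R\<^esub>"
      by (auto simp: p_def E_def PSL2R_diag_def PSL2R_class_one PSL2R_class_eq mat_def vec_eq_iff forall_2)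
    have "norm (matrix_inv (p s) ** vector_derivative p (at s)) = \<bar>t\<bar> / sqrt 2" for s
    proof -
      have dp: "det (p s) = 1" by (simp add: p_def E_def det_2 flip: exp_add)
      have "matrix_inv (p s) ** vector_derivative p (at s) = vector [vector [- t / 2, 0], vector [0, t / 2]]"
        unfolding matrix_inv_SL2R_explicit[OF dp] vector_derivative_at[OF D]
        by (simp add: vec_eq_iff forall_2 matrix_matrix_mult_def sum_2 p_def E_def E'_def flip: exp_add)
      then have "(norm (matrix_inv (p s) ** vector_derivative p (at s)))\<^sup>2 = (\<bar>t\<bar> / sqrt 2)\<^sup>2"
        by (simp add: norm_matrix_2 power_divide)
      then show ?thesis by (rule power2_eq_imp_eq) auto
    qed
    then show "((\<lambda>s. norm (matrix_inv (p s) ** vector_derivative p (at s))) has_integral \<bar>t\<bar> / sqrt 2) {0..1}"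
      using has_integral_const_real[of "\<bar>t\<bar> / sqrt 2" 0 1] by simp
  qed
  then show ?thesis
    unfolding PSL2R_dist_def by (intro cInf_eq_minimum lower)
qed

end

theory Submission
  imports Defs
begin

text \<open>
  Two points on one horocycle, \<open>\<Gamma>\<close> and \<open>\<Gamma>u\<close> with \<open>u\<close> unipotent and close to \<open>1\<close>, stay close
  for all \<open>t \<ge> 0\<close> (upper triangular \<open>u\<close>) or all \<open>t \<le> 0\<close> (lower triangular \<open>u\<close>), because conjugation
  by \<open>a\<^sub>t\<close> contracts \<open>u\<close>. They lie on one orbit only if \<open>u a\<^sub>\<tau> \<in> \<Gamma>\<close> for some \<open>\<tau>\<close>. The product
  \<open>u a\<^sub>\<tau>\<close> determines \<open>u\<close>, and \<open>\<Gamma>\<close> is countable, so all but countably many \<open>u\<close> are not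
  on the orbit.
\<close>

section \<open>Upper bounds for the distances on the group and on its quotient\<close>

lemma matrix_add_rdistrib:
  fixes A B :: "'a::semiring_1^'n^'m" and C :: "'a^'k^'n"
  shows "(A + B) ** C = A ** C + B ** C"
  by (simp add: vec_eq_iff matrix_matrix_mult_def sum.distrib distrib_right)

text \<open>The straight segment \<open>mat 1 + s *\<^sub>R N\<close> does it: as N squares to 0, (1
  + sN)N = N, so the velocity translated back to the identity is constantly
  \<open>N\<close>.\<close>

lemma PSL2R_lengths_unipotent:
  fixes N :: "real^2^2"
  assumes N: "N ** N = 0" "\<And>x. det (mat 1 + x *\<^sub>R N) = 1"
  shows "norm N \<in> PSL2R_lengths \<one>\<^bsub>PSL2R\<^esub> (PSL2R_class (mat 1 + N))"
  unfolding PSL2R_lengths_def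
proof (intro CollectI exI conjI)
  define p where "p = (\<lambda>s :: real. mat 1 + s *\<^sub>R N)"
  have D: "(p has_vector_derivative N) (at s)" for s
    unfolding p_def by (auto intro!: derivative_eq_intros)
  show "p piecewise_C1_differentiable_on {0..1}"
    using D by (intro C1_differentiable_imp_piecewise)
      (auto simp: C1_differentiable_on_def intro!: exI[of _ "\<lambda>_. N"])
  show "p ` {0..1} \<subseteq> carrier SL2R"
    by (auto simp: p_def carrier_SL2R N)
  show "p 0 \<in> \<one>\<^bsub>PSL2R\<^esub>" "p 1 \<in> PSL2R_class (mat 1 + N)"
    by (simp_all add: p_def PSL2R_class_one PSL2R_class_eq)
  have "matrix_inv (p s) ** vector_derivative p (at s) = N" for s
  proof -
    have "N = p s ** N"
      by (simp add: p_def matrix_add_rdistrib N flip: scalar_matrix_assoc)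
    then have "matrix_inv (p s) ** N = matrix_inv (p s) ** p s ** N"
      by (metis matrix_mul_assoc)
    also have "\<dots> = N"
      by (simp add: matrix_inv_SL2R p_def N)
    finally show ?thesis by (simp add: vector_derivative_at[OF D])
  qed
  then show "((\<lambda>s. norm (matrix_inv (p s) ** vector_derivative p (at s))) has_integral norm N) {0..1}"
    using has_integral_const_real[of "norm N" 0 1] by simp
qed

lemma PSL2R_dist_le:
  assumes "L \<in> PSL2R_lengths g h"
  shows "PSL2R_dist g h \<le> L"
  unfolding PSL2R_dist_def
  using assms by (intro cInf_lower bdd_belowI[of _ 0]) (auto dest: PSL2R_lengths_nonneg)

text \<open>\<open>Inf {}\<close> accounts for pairs not joined by a curve; this avoids proving that there are none.\<close>

lemma PSL2R_dist_bounded_below: "min 0 (Inf {}) \<le> PSL2R_dist g h"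
proof (cases "PSL2R_lengths g h = {}")
  case False
  then have "0 \<le> PSL2R_dist g h"
    unfolding PSL2R_dist_def by (intro cInf_greatest) (auto dest: PSL2R_lengths_nonneg)
  then show ?thesis by simp
qed (simp add: PSL2R_dist_def)

lemma coset_dist_le:
  assumes "subgroup \<Gamma> PSL2R" "g \<in> carrier PSL2R" "h \<in> carrier PSL2R"
  shows "coset_dist \<Gamma> (\<Gamma> #>\<^bsub>PSL2R\<^esub> g) (\<Gamma> #>\<^bsub>PSL2R\<^esub> h) \<le> PSL2R_dist g h"
proof -
  \<comment> \<open>The neutral element contributes one term of the infimum. The family has to be
    bounded below, and \<open>min 0 (Inf {})\<close> is a bound independent of \<gamma>.\<close>
  have "(INF \<gamma>\<in>\<Gamma>. PSL2R_dist g (\<gamma> \<otimes>\<^bsub>PSL2R\<^esub> h)) \<le> PSL2R_dist g (\<one>\<^bsub>PSL2R\<^esub> \<otimes>\<^bsub>PSL2R\<^esub> h)"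
    by (rule cINF_lower)
      (auto intro!: bdd_belowI[of _ "min 0 (Inf {})"] PSL2R_dist_bounded_below
        simp: subgroup.one_closed[OF assms(1)] simp del: min_le_iff_disj)
  then show ?thesis
    using assms by (simp add: coset_dist_eq)
qed

section \<open>Countability of discrete subgroups\<close>

text \<open>Each class in \<Gamma> has an open neighbourhood containing no matrices over \<Gamma>
  but its own two; by the Lindelof property countably many such neighbourhoods suffice. Matrices are
  counted rather than classes, since \<open>f\<close> below reads off matrix entries.\<close>

lemma countable_Union_discrete:
  assumes "subgroup \<Gamma> PSL2R" "discrete_in_PSL2R \<Gamma>"
  shows "countable (\<Union>\<Gamma>)"
proof -
  have sub: "\<Gamma> \<subseteq> PSL2R_class ` carrier SL2R"
    using subgroup.subset[OF assms(1)] by (simp add: carrier_PSL2R)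
  have ex: "\<forall>g\<in>\<Gamma>. \<exists>V. openin (top_of_set (carrier SL2R)) V \<and> g \<subseteq> V \<and> countable (V \<inter> \<Union>\<Gamma>)"
  proof
    fix g assume g: "g \<in> \<Gamma>"
    have "openin (subtopology PSL2R_topology \<Gamma>) {g}"
      using assms(2) g by (simp add: discrete_in_PSL2R_def)
    then obtain U where U: "openin PSL2R_topology U" "U \<inter> \<Gamma> = {g}"
      by (auto simp: openin_subtopology)
    \<comment> \<open>The preimage of an open set isolating \<open>g\<close>, hence open by
      continuity of the quotient map.\<close>
    define V where "V = {A \<in> carrier SL2R. PSL2R_class A \<in> U}"
    have "quotient_map (top_of_set (carrier SL2R)) PSL2R_topology PSL2R_class"
      unfolding PSL2R_topology_def by (rule quotient_map_quotient_topology)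
    from openin_continuous_map_preimage[OF quotient_imp_continuous_map[OF this] U(1)]
    have "openin (top_of_set (carrier SL2R)) V"
      by (simp add: V_def)
    moreover have cls: "PSL2R_class A = h" "A \<in> carrier SL2R" if "A \<in> h" "h \<in> \<Gamma>" for A h
      using that sub by (auto simp: PSL2R_class_eq carrier_SL2R det_minus_2 dest!: subsetD)
    have "g \<subseteq> V"
      using cls[OF _ g] U(2) by (auto simp: V_def)
    moreover have "V \<inter> \<Union>\<Gamma> \<subseteq> g"
      using cls U(2) by (auto simp: V_def)
    moreover have "countable g"
      using g sub by (auto simp: PSL2R_class_eq)
    ultimately show "\<exists>V. openin (top_of_set (carrier SL2R)) V \<and> g \<subseteq> V \<and> countable (V \<inter> \<Union>\<Gamma>)"
      by (intro exI[of _ V] conjI) (auto intro: countable_subset)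
  qed
  obtain V where V: "\<forall>g\<in>\<Gamma>. openin (top_of_set (carrier SL2R)) (V g) \<and> g \<subseteq> V g \<and>
      countable (V g \<inter> \<Union>\<Gamma>)"
    by (rule exE[OF bchoice[OF ex]])
  have "openin (top_of_set (carrier SL2R)) W" if "W \<in> V ` \<Gamma>" for W
    using that V by auto
  from Lindelof_openin[OF this] obtain \<F> where
    \<F>: "\<F> \<subseteq> V ` \<Gamma>" "countable \<F>" "\<Union>\<F> = \<Union>(V ` \<Gamma>)"
    by metis
  have "\<Union>\<Gamma> \<subseteq> (\<Union>W\<in>\<F>. W \<inter> \<Union>\<Gamma>)"
  proof -
    have "\<Union>\<Gamma> \<subseteq> \<Union>\<F>"
      unfolding \<F>(3) using V by (intro Union_least) auto
    then show ?thesis by auto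
  qed
  moreover have "countable (\<Union>W\<in>\<F>. W \<inter> \<Union>\<Gamma>)"
    using \<F>(1,2) V by (intro countable_UN) auto
  ultimately show ?thesis
    by (rule countable_subset)
qed

section \<open>Conjugation by the diagonal subgroup\<close>

definition SL2R_diag :: "real \<Rightarrow> real^2^2" where
  "SL2R_diag t = vector [vector [exp (t / 2), 0], vector [0, exp (- t / 2)]]"

lemma PSL2R_diag_eq: "PSL2R_diag t = PSL2R_class (SL2R_diag t)"
  by (simp add: PSL2R_diag_def SL2R_diag_def)

lemma det_SL2R_diag: "det (SL2R_diag t) = 1"
  by (simp add: SL2R_diag_def det_2 flip: exp_add)

lemma PSL2R_diag_closed: "PSL2R_diag t \<in> carrier PSL2R"
  by (auto simp: PSL2R_diag_eq carrier_PSL2R carrier_SL2R det_SL2R_diag)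

lemma SL2R_diag_inverse: "SL2R_diag t ** SL2R_diag (- t) = mat 1"
  by (simp add: SL2R_diag_def vec_eq_iff forall_2 matrix_matrix_mult_def sum_2 mat_def flip: exp_add)

text \<open>With M the conjugate of N, (1 + N) a_t = a_t (1 + M), so left invariance leaves the
  distance from 1 to 1 + M. Like N, M has at most one nonzero entry, which is off the diagonal; thus
  M squares to 0 and the segment bound applies.\<close>

lemma PSL2R_dist_diag_unipotent_le:
  fixes N :: "real^2^2"
  assumes "N$1$1 = 0" "N$2$2 = 0" "N$1$2 * N$2$1 = 0"
  shows "PSL2R_dist (PSL2R_diag t) (PSL2R_class (mat 1 + N) \<otimes>\<^bsub>PSL2R\<^esub> PSL2R_diag t)
    \<le> norm (SL2R_diag (- t) ** N ** SL2R_diag t)"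
proof -
  define M where "M = SL2R_diag (- t) ** N ** SL2R_diag t"
  have M: "M$1$1 = 0" "M$2$2 = 0" "M$1$2 * M$2$1 = 0"
    using assms by (auto simp: M_def SL2R_diag_def matrix_matrix_mult_def sum_2)
  have detM: "det (mat 1 + x *\<^sub>R M) = 1" for x
    using M by (auto simp: det_2 mat_def)
  have detN: "det (mat 1 + N) = 1"
    using assms by (auto simp: det_2 mat_def)
  have "SL2R_diag t ** (mat 1 + M) = SL2R_diag t + SL2R_diag t ** SL2R_diag (- t) ** N ** SL2R_diag t"
    by (simp only: M_def matrix_add_ldistrib matrix_mul_rid matrix_mul_assoc)
  also have "\<dots> = (mat 1 + N) ** SL2R_diag t"
    by (simp only: SL2R_diag_inverse matrix_add_rdistrib matrix_mul_lid)
  finally have "PSL2R_class (mat 1 + N) \<otimes>\<^bsub>PSL2R\<^esub> PSL2R_diag t =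
      PSL2R_diag t \<otimes>\<^bsub>PSL2R\<^esub> PSL2R_class (mat 1 + M)"
    using detM[of 1] detN by (simp add: PSL2R_diag_eq PSL2R_class_mult det_SL2R_diag)
  moreover have "PSL2R_dist (PSL2R_diag t \<otimes>\<^bsub>PSL2R\<^esub> \<one>\<^bsub>PSL2R\<^esub>)
      (PSL2R_diag t \<otimes>\<^bsub>PSL2R\<^esub> PSL2R_class (mat 1 + M)) = PSL2R_dist \<one>\<^bsub>PSL2R\<^esub> (PSL2R_class (mat 1 + M))"
    using detM[of 1]
    by (intro PSL2R_dist_left_invariant PSL2R_diag_closed PSL2R.one_closed)
      (auto simp: carrier_PSL2R carrier_SL2R)
  moreover have "M ** M = 0"
    using M by (auto simp: vec_eq_iff forall_2 matrix_matrix_mult_def sum_2)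
  ultimately show ?thesis
    using PSL2R_dist_le[OF PSL2R_lengths_unipotent[of M]] detM PSL2R_diag_closed
    by (simp add: M_def)
qed

section \<open>Close orbits that differ\<close>

text \<open>Serves both time directions: the conditions on the entries force \<open>N\<close> to be
  one of the two off-diagonal matrix units, and \<open>T\<close> is the half-line on which
  conjugation does not expand it.\<close>

lemma geodesic_flow_not_separating_on:
  fixes N :: "real^2^2"
  assumes \<Gamma>: "subgroup \<Gamma> PSL2R" "discrete_in_PSL2R \<Gamma>"
    and N: "N$1$1 = 0" "N$2$2 = 0" "N$1$2 * N$2$1 = 0" "N$1$2 + N$2$1 = 1"
    and T: "\<And>t. t \<in> T \<Longrightarrow> norm (SL2R_diag (- t) ** N ** SL2R_diag t) \<le> 1"
    and \<delta>: "\<delta> > 0"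
  shows "\<exists>x\<in>T1_surface \<Gamma>. \<exists>y\<in>T1_surface \<Gamma>.
    (\<forall>t\<in>T. T1_dist \<Gamma> (geodesic_flow \<Gamma> t x) (geodesic_flow \<Gamma> t y) < \<delta>) \<and>
    (\<forall>\<tau>. y \<noteq> geodesic_flow \<Gamma> \<tau> x)"
proof -
  \<comment> \<open>\<open>f\<close> recovers \<open>s\<close> from \<open>\<plusminus>(1 + s N) a\<^sub>\<tau>\<close>; one of its two summands vanishes there.\<close>
  define f :: "real^2^2 \<Rightarrow> real" where "f = (\<lambda>A. A$1$2 / A$2$2 + A$2$1 / A$1$1)"
  have "countable (f ` \<Union>\<Gamma>)"
    using countable_Union_discrete[OF \<Gamma>] by (rule countable_image)
  moreover have "uncountable {0<..<\<delta>}"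
    using \<delta> by (simp add: uncountable_open_interval)
  \<comment> \<open>The bound s < \<delta> gives closeness; avoiding the values of \<open>f\<close>
    keeps the two points off a common orbit.\<close>
  ultimately obtain s where s: "0 < s" "s < \<delta>" "s \<notin> f ` \<Union>\<Gamma>"
    by (metis countable_subset greaterThanLessThan_iff subsetI)
  define u where "u = PSL2R_class (mat 1 + s *\<^sub>R N)"
  have det: "det (mat 1 + s *\<^sub>R N) = 1"
    using N by (auto simp: det_2 mat_def)
  have u: "u \<in> carrier PSL2R"
    using det by (auto simp: u_def carrier_PSL2R carrier_SL2R)
  have cosets: "\<Gamma> #>\<^bsub>PSL2R\<^esub> g \<in> rcosets\<^bsub>PSL2R\<^esub> \<Gamma>" if "g \<in> carrier PSL2R" for g
    using that by (auto simp: RCOSETS_def)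
  have inj: "inj_on Xi_inv (rcosets\<^bsub>PSL2R\<^esub> \<Gamma>)" and surj: "Xi_inv ` (rcosets\<^bsub>PSL2R\<^esub> \<Gamma>) = T1_surface \<Gamma>"
    using bij_betw_Xi_inv[OF \<Gamma>(1)] by (auto simp: bij_betw_def)
  \<comment> \<open>In terms of \<open>v\<close>, the geodesic flow becomes right multiplication of
    representatives by a_t.\<close>
  define v where "v = (\<lambda>g. Xi_inv (\<Gamma> #>\<^bsub>PSL2R\<^esub> g))"
  have v_in: "v g \<in> T1_surface \<Gamma>" if "g \<in> carrier PSL2R" for g
    using cosets[OF that] surj by (auto simp: v_def)
  have Xi: "Xi \<Gamma> (v g) = \<Gamma> #>\<^bsub>PSL2R\<^esub> g" if "g \<in> carrier PSL2R" for g
    unfolding Xi_def v_def by (rule the_inv_into_f_f[OF inj cosets[OF that]])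
  have flow: "geodesic_flow \<Gamma> t (v g) = v (g \<otimes>\<^bsub>PSL2R\<^esub> PSL2R_diag t)" if "g \<in> carrier PSL2R" for g t
    using that subgroup.subset[OF \<Gamma>(1)]
    by (simp add: geodesic_flow_def Xi coset_flow_def PSL2R.coset_mult_assoc PSL2R_diag_closed)
      (simp add: v_def)
  have "T1_dist \<Gamma> (geodesic_flow \<Gamma> t (v \<one>\<^bsub>PSL2R\<^esub>)) (geodesic_flow \<Gamma> t (v u)) < \<delta>" if t: "t \<in> T" for t
  proof -
    have "T1_dist \<Gamma> (geodesic_flow \<Gamma> t (v \<one>\<^bsub>PSL2R\<^esub>)) (geodesic_flow \<Gamma> t (v u))
        \<le> PSL2R_dist (PSL2R_diag t) (u \<otimes>\<^bsub>PSL2R\<^esub> PSL2R_diag t)"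
      using u by (simp add: T1_dist_def flow Xi PSL2R_diag_closed coset_dist_le \<Gamma>)
    also have "\<dots> \<le> norm (SL2R_diag (- t) ** (s *\<^sub>R N) ** SL2R_diag t)"
      unfolding u_def by (rule PSL2R_dist_diag_unipotent_le) (use N in auto)
    also have "\<dots> = s * norm (SL2R_diag (- t) ** N ** SL2R_diag t)"
      using s(1) by (simp only: matrix_scalar_ac flip: scalar_matrix_assoc) simp
    also have "\<dots> \<le> s"
      using T[OF t] s(1) by (simp add: mult_left_le)
    finally show ?thesis using s(2) by simp
  qed
  moreover have "v u \<noteq> geodesic_flow \<Gamma> \<tau> (v \<one>\<^bsub>PSL2R\<^esub>)" for \<tau>
  proof
    assume "v u = geodesic_flow \<Gamma> \<tau> (v \<one>\<^bsub>PSL2R\<^esub>)"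
    then have "\<Gamma> #>\<^bsub>PSL2R\<^esub> u = \<Gamma> #>\<^bsub>PSL2R\<^esub> PSL2R_diag \<tau>"
      using u cosets PSL2R_diag_closed by (simp add: flow) (simp add: v_def inj_on_eq_iff[OF inj])
    then have "u \<in> \<Gamma> #>\<^bsub>PSL2R\<^esub> PSL2R_diag \<tau>"
      using PSL2R.rcos_self[OF u \<Gamma>(1)] by simp
    then obtain \<gamma> where \<gamma>: "\<gamma> \<in> \<Gamma>" "u = \<gamma> \<otimes>\<^bsub>PSL2R\<^esub> PSL2R_diag \<tau>"
      by (auto simp: r_coset_def)
    obtain A where A: "\<gamma> = PSL2R_class A" "det A = 1"
      using \<gamma>(1) subgroup.subset[OF \<Gamma>(1)] by (auto simp: carrier_PSL2R carrier_SL2R dest!: subsetD)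
    have "PSL2R_class (mat 1 + s *\<^sub>R N) = PSL2R_class (A ** SL2R_diag \<tau>)"
      using \<gamma>(2) A by (simp add: u_def PSL2R_diag_eq PSL2R_class_mult det_SL2R_diag)
    \<comment> \<open>Equal classes determine the matrices only up to sign; this is harmless because
      \<open>f\<close> is even.\<close>
    then have *: "A ** SL2R_diag \<tau> = mat 1 + s *\<^sub>R N \<or> - A ** SL2R_diag \<tau> = mat 1 + s *\<^sub>R N"
      by (auto simp: PSL2R_class_eq minus_matrix_mult doubleton_eq_iff)
    \<comment> \<open>Right multiplication by a diagonal matrix scales columns, and each quotient in
      \<open>f\<close> is taken within one column, so \<tau> cancels.\<close>
    have "f B = s" if "B ** SL2R_diag \<tau> = mat 1 + s *\<^sub>R N" for B
    proof -
      have "B$1$1 * exp (\<tau> / 2) = 1" "B$1$2 * exp (- \<tau> / 2) = s * N$1$2"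
        "B$2$1 * exp (\<tau> / 2) = s * N$2$1" "B$2$2 * exp (- \<tau> / 2) = 1"
        using that N(1,2) by (simp_all add: SL2R_diag_def vec_eq_iff forall_2 matrix_matrix_mult_def sum_2 mat_def)
      then have "B$1$2 / B$2$2 = s * N$1$2" "B$2$1 / B$1$1 = s * N$2$1"
        by (metis div_by_1 exp_not_eq_zero nonzero_mult_divide_mult_cancel_right)+
      then show ?thesis
        using N(4) by (simp add: f_def flip: distrib_left)
    qed
    with * have "f A = s \<or> f (- A) = s" by blast
    then have "f A = s" by (simp add: f_def)
    moreover have "A \<in> \<Union>\<Gamma>"
      using \<gamma>(1) A(1) by (intro UnionI[of \<gamma>]) (simp_all add: PSL2R_class_eq)
    ultimately show False
      using s(3) by blast
  qed
  ultimately show ?thesis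
    by (intro bexI[of _ "v \<one>\<^bsub>PSL2R\<^esub>"] bexI[of _ "v u"] conjI ballI allI v_in u PSL2R.one_closed)
qed

theorem mainTheorem5:
  fixes \<Gamma> :: "(real^2^2) set set"
  assumes "subgroup \<Gamma> PSL2R"
    and "discrete_in_PSL2R \<Gamma>"
    and "acts_freely \<Gamma>"
    and "compact_space (quotient_surface \<Gamma>)"
  shows "\<not> positive_separating (T1_surface \<Gamma>) (T1_dist \<Gamma>) (geodesic_flow \<Gamma>) \<and>
         \<not> negative_separating (T1_surface \<Gamma>) (T1_dist \<Gamma>) (geodesic_flow \<Gamma>)"
proof
  \<comment> \<open>Conjugation multiplies \<open>P\<close> by exp(-t) and \<open>Q\<close> by
    exp(t), so the norms stay at most 1 for t \<ge> 0 and t \<le> 0 respectively.\<close>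
  define P Q :: "real^2^2"
    where "P = vector [vector [0, 1], vector [0, 0]]" and "Q = vector [vector [0, 0], vector [1, 0]]"
  have "(norm (SL2R_diag (- t) ** P ** SL2R_diag t))\<^sup>2 = (exp (- t))\<^sup>2" for t
    by (simp add: norm_matrix_2 SL2R_diag_def P_def matrix_matrix_mult_def sum_2 flip: exp_add)
  then have P: "norm (SL2R_diag (- t) ** P ** SL2R_diag t) = exp (- t)" for t
    by (rule power2_eq_imp_eq) auto
  have "(norm (SL2R_diag (- t) ** Q ** SL2R_diag t))\<^sup>2 = (exp t)\<^sup>2" for t
    by (simp add: norm_matrix_2 SL2R_diag_def Q_def matrix_matrix_mult_def sum_2 flip: exp_add)
  then have Q: "norm (SL2R_diag (- t) ** Q ** SL2R_diag t) = exp t" for t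
    by (rule power2_eq_imp_eq) auto
  show "\<not> positive_separating (T1_surface \<Gamma>) (T1_dist \<Gamma>) (geodesic_flow \<Gamma>)"
  proof -
    have "\<exists>x\<in>T1_surface \<Gamma>. \<exists>y\<in>T1_surface \<Gamma>.
        (\<forall>t\<in>{0..}. T1_dist \<Gamma> (geodesic_flow \<Gamma> t x) (geodesic_flow \<Gamma> t y) < \<delta>) \<and>
        (\<forall>\<tau>. y \<noteq> geodesic_flow \<Gamma> \<tau> x)" if "\<delta> > 0" for \<delta>
      using P that
      by (intro geodesic_flow_not_separating_on[OF assms(1,2), of P]) (simp_all add: P_def)
    then show ?thesis
      unfolding positive_separating_def by (meson atLeast_iff atMost_iff)
  qed
  show "\<not> negative_separating (T1_surface \<Gamma>) (T1_dist \<Gamma>) (geodesic_flow \<Gamma>)"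
  proof -
    have "\<exists>x\<in>T1_surface \<Gamma>. \<exists>y\<in>T1_surface \<Gamma>.
        (\<forall>t\<in>{..0}. T1_dist \<Gamma> (geodesic_flow \<Gamma> t x) (geodesic_flow \<Gamma> t y) < \<delta>) \<and>
        (\<forall>\<tau>. y \<noteq> geodesic_flow \<Gamma> \<tau> x)" if "\<delta> > 0" for \<delta>
      using Q that
      by (intro geodesic_flow_not_separating_on[OF assms(1,2), of Q]) (simp_all add: Q_def)
    then show ?thesis
      unfolding negative_separating_def by (meson atLeast_iff atMost_iff)
  qed
qed

end
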